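(* Let $q$ be a positive integer and $\mathcal{Q}=\{0,1,\ldots,q-1\}$. A two-input $q$-state CA rule $f:\mathcal{Q}^2\to\mathcal{Q}$ is number-conserving if and only if there exists a sequence of integers $a_1,a_2,\ldots,a_q$ satisfying $$\max\{1-k+a_1,\,0\}\le a_k\le \min\{a_1,\,q-k\}\quad\text{for all } k\in\{1,2,\ldots,q\}$$ such that $$f(i,j)=i+a_{q-j}-a_{q-i}\quad\text{for all } i,j\in\mathcal{Q}.$$
   Context: For a positive integer $q$, let $\mathcal{Q}=\{0,1,\ldots,q-1\}$. A two-input $q$-state CA (cellular automaton) rule is a function $f:\mathcal{Q}^2\to\mathcal{Q}$. The rule $f$ is number-conserving if for every integer $L\ge 2$ and every cyclic configuration $(x_1,x_2,\ldots,x_L)\in\mathcal{Q}^L$, $$f(x_1,x_2)+f(x_2,x_3)+\cdots+f(x_{L-1},x_L)+f(x_L,x_1)=x_1+x_2+\cdots+x_L,$$ where sums are ordinary sums of integers. *)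

theory Defs
  imports Main
begin

definition states :: "nat \<Rightarrow> nat set" where
  "states q = {0..<q}"

text \<open>A rule on \<^term>\<open>states q\<close> is a function on all of \<^typ>\<open>nat\<close>; its values outside
  \<^term>\<open>states q\<close> are irrelevant, and no notion below refers to them.\<close>

definition two_input_rule :: "nat \<Rightarrow> (nat \<Rightarrow> nat \<Rightarrow> nat) \<Rightarrow> bool" where
  "two_input_rule q f \<longleftrightarrow> (\<forall>i \<in> states q. \<forall>j \<in> states q. f i j \<in> states q)"

text \<open>A cyclic configuration of length \<open>L\<close> is given by the values of \<open>x\<close> on \<open>{1..L}\<close>.\<close>

definition number_conserving :: "nat \<Rightarrow> (nat \<Rightarrow> nat \<Rightarrow> nat) \<Rightarrow> bool" where
  "number_conserving q f \<longleftrightarrow>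
     (\<forall>L \<ge> 2. \<forall>x :: nat \<Rightarrow> nat. (\<forall>k \<in> {1..L}. x k \<in> states q) \<longrightarrow>
        (\<Sum>k = 1..L - 1. f (x k) (x (k + 1))) + f (x L) (x 1) = (\<Sum>k = 1..L. x k))"

end

(* Write f(i, j) = i + g(i, j). Conservation on cyclic configurations of length 2 and 3 makes g an
   additive cocycle, so g(i, j) = h(j) - h(i) with h(j) = f(0, j), and a_k = h(q - k). The four bounds
   on a_k say exactly that f(0, j), f(j, 0), f(q-1, j) and f(j, q-1) are states. Conversely, the
   potential terms cancel around any cycle. *)
theory Submission
  imports Defs
begin

lemma number_conserving_two:
  assumes "number_conserving q f" "i \<in> states q" "j \<in> states q"
  shows "f i j + f j i = i + j"
proof -
  define x :: "nat \<Rightarrow> nat" where "x k = (if k = 1 then i else j)" for k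
  have "\<forall>k \<in> {1..2}. x k \<in> states q"
    using assms(2,3) by (simp add: x_def)
  with assms(1) have "(\<Sum>k = 1..2 - 1. f (x k) (x (k + 1))) + f (x 2) (x 1) = (\<Sum>k = 1..2. x k)"
    unfolding number_conserving_def by blast
  then show ?thesis
    by (simp add: x_def numeral_2_eq_2)
qed

lemma number_conserving_three:
  assumes "number_conserving q f" "i \<in> states q" "j \<in> states q" "k \<in> states q"
  shows "f i j + f j k + f k i = i + j + k"
proof -
  define x :: "nat \<Rightarrow> nat" where "x l = (if l = 1 then i else if l = 2 then j else k)" for l
  have "\<forall>l \<in> {1..3}. x l \<in> states q"
    using assms(2-4) by (simp add: x_def)
  moreover have "(2::nat) \<le> 3" by simp
  ultimately have "(\<Sum>l = 1..3 - 1. f (x l) (x (l + 1))) + f (x 3) (x 1) = (\<Sum>l = 1..3. x l)"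
    using assms(1) unfolding number_conserving_def by blast
  then show ?thesis
    by (simp add: x_def numeral_2_eq_2 numeral_3_eq_3)
qed

text \<open>The cycle (0, i, j) gives \<open>f 0 i + f i j + f j 0 = i + j\<close>, and the cycle
  (0, j) gives \<open>f 0 j + f j 0 = j\<close>; subtracting eliminates
  \<open>f j 0\<close>.\<close>

lemma number_conserving_potential:
  assumes "number_conserving q f" "i \<in> states q" "j \<in> states q"
  shows "int (f i j) = int i + int (f 0 j) - int (f 0 i)"
proof -
  have "0 \<in> states q"
    using assms(2) by (simp add: states_def)
  then show ?thesis
    using number_conserving_three[OF assms(1) _ assms(2,3), of 0]
      number_conserving_two[OF assms(1) _ assms(3), of 0] by linarith
qed

lemma number_conserving_if_potential:
  fixes h :: "nat \<Rightarrow> int"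
  assumes "\<And>i j. i \<in> states q \<Longrightarrow> j \<in> states q \<Longrightarrow> int (f i j) = int i + h j - h i"
  shows "number_conserving q f"
  unfolding number_conserving_def
proof (intro allI impI)
  fix L :: nat and x :: "nat \<Rightarrow> nat"
  assume "2 \<le> L" and x: "\<forall>k \<in> {1..L}. x k \<in> states q"
  then obtain n where L: "L = Suc n"
    by (cases L) auto
  have "(\<Sum>k = 1..n. int (f (x k) (x (k + 1)))) = (\<Sum>k = 1..n. int (x k) + (h (x (Suc k)) - h (x k)))"
    using assms x L by (intro sum.cong) auto
  \<comment> \<open>The differences of \<open>h\<close> telescope along the open path from
    \<open>x 1\<close> to \<open>x L\<close>; the closing term, split off by
    \<open>L = Suc n\<close>, contributes the opposite difference.\<close>
  also have "\<dots> = (\<Sum>k = 1..n. int (x k)) + (h (x L) - h (x 1))"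
    using sum_Suc_diff[of 1 n "\<lambda>k. h (x k)"] L by (simp add: sum.distrib)
  moreover have "int (f (x L) (x 1)) = int (x L) + h (x 1) - h (x L)"
    using assms x L by simp
  ultimately have "int ((\<Sum>k = 1..L - 1. f (x k) (x (k + 1))) + f (x L) (x 1)) = int (\<Sum>k = 1..L. x k)"
    using L by simp
  then show "(\<Sum>k = 1..L - 1. f (x k) (x (k + 1))) + f (x L) (x 1) = (\<Sum>k = 1..L. x k)"
    by (simp only: of_nat_eq_iff)
qed

theorem proposition2:
  fixes q :: nat and f :: "nat \<Rightarrow> nat \<Rightarrow> nat"
  assumes "q \<ge> 1" and "two_input_rule q f"
  shows "number_conserving q f \<longleftrightarrow>
    (\<exists>a :: nat \<Rightarrow> int.
       (\<forall>k \<in> {1..q}. max (1 - int k + a 1) 0 \<le> a k \<and> a k \<le> min (a 1) (int q - int k)) \<and>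
       (\<forall>i \<in> states q. \<forall>j \<in> states q. int (f i j) = int i + a (q - j) - a (q - i)))"
    (is "_ \<longleftrightarrow> (\<exists>a. ?bounds a \<and> ?formula a)")
proof
  assume nc: "number_conserving q f"
  \<comment> \<open>The index is reversed, so \<open>a 1\<close> belongs to the largest state and
    \<open>a q\<close> to state 0. For \<open>j < q\<close> the truncated subtraction is exact and
    \<open>q - (q - j) = j\<close>.\<close>
  define a where "a k = int (f 0 (q - k))" for k
  have f_less: "f i j < q" if "i < q" "j < q" for i j
    using assms(2) that by (simp add: two_input_rule_def states_def)
  have pot: "int (f i j) = int i + int (f 0 j) - int (f 0 i)" if "i < q" "j < q" for i j
    by (rule number_conserving_potential[OF nc]) (simp_all add: states_def that)
  have "?bounds a"
  proof
    fix k assume k: "k \<in> {1..q}"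
    define j m where "j = q - k" and "m = q - 1"
    have jm: "j < q" "m < q" "int j = int q - int k" "int m = int q - 1"
      using k by (auto simp: j_def m_def of_nat_diff)
    have a: "a k = int (f 0 j)" "a 1 = int (f 0 m)"
      by (simp_all add: a_def j_def m_def)
    have "int (f 0 0) = 0"
      using pot[of 0 0] jm(1) by simp
    \<comment> \<open>Since \<open>f 0 0 = 0\<close>, the potential form gives
      \<open>f j 0 = j - f 0 j\<close>, which is nonnegative. This is the bound
      \<open>a k \<le> q - k\<close>.\<close>
    then have "int (f 0 j) \<le> int j"
      using pot[of j 0] jm(1) by simp
    \<comment> \<open>Here \<open>f j m = q - k + a 1 - a k\<close> yields the lower bound
      \<open>1 - k + a 1\<close>, and \<open>f m j = q - 1 + a k - a 1\<close> yields
      \<open>a k \<le> a 1\<close>.\<close>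
    moreover have "int (f j m) \<le> int q - 1" "int (f m j) \<le> int q - 1"
      using f_less[OF jm(1,2)] f_less[OF jm(2,1)] by simp_all
    ultimately have "1 - int k + a 1 \<le> a k" "a k \<le> a 1" "a k \<le> int q - int k"
      using pot[OF jm(1,2)] pot[OF jm(2,1)] jm(3,4) a by simp_all
    moreover have "0 \<le> a k"
      by (simp add: a)
    ultimately show "max (1 - int k + a 1) 0 \<le> a k \<and> a k \<le> min (a 1) (int q - int k)"
      by simp
  qed
  moreover have "?formula a"
  proof (intro ballI)
    fix i j assume "i \<in> states q" "j \<in> states q"
    then show "int (f i j) = int i + a (q - j) - a (q - i)"
      using pot[of i j] unfolding a_def states_def by simp
  qed
  ultimately show "\<exists>a. ?bounds a \<and> ?formula a" by blast
next
  assume "\<exists>a. ?bounds a \<and> ?formula a"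
  then obtain a where "?formula a" by blast
  then show "number_conserving q f"
    by (intro number_conserving_if_potential[where h = "\<lambda>i. a (q - i)"]) blast
qed

end
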